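(* Let $n$ be a positive integer and let $M$ and $N$ be fb-tableaux of size $n$. Let $L$ be the tableau defined as follows: (a) the root of $L$ is a dot; (b) in each of the columns $1,\dots,n-1$, the up-arrow of $L$ is at the position of the lowest of the up-arrows of $M$ and $N$ in that column; (c) in each row $2,\dots,n$, the left-arrow of $L$ is at the position of the leftmost of the left-arrows of $M$ and $N$ in that row, except that if this position is pointed by an up-arrow of $L$, it is moved to the left to the first position which is not pointed by an up-arrow of $L$; (d) a free cell $c$ of $L$ (a cell strictly below the up-arrow of $L$ in its column and strictly to the right of the left-arrow of $L$ in its row) contains a dot in $L$ if and only if [$c$ contains a dot in $M$ or is not free in $M$] and [$c$ contains a dot in $N$ or is not free in $N$]; all other cells of $L$ are empty. Then: (1) If a cell is free in $L$, then it is free in $M$ or in $N$. If a cell is free in $M$ and in $N$, then it is free in $L$. (2) Let $c$ be a border cell and let $e_M,e_N,e_L\in\{\uparrow,\bullet,\leftarrow\}$ be the elements (up-arrow, dot or left-arrow) contained in $c$ in $M$, $N$ and $L$ respectively. Then $e_L=\min(e_M,e_N)$ with respect to the total order $\uparrow\,\le\,\bullet\,\le\,\leftarrow$. (3) The tableau $L$ is an fb-tableau.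
   Context: Let $n$ be a positive integer. The board of size $n$ is the Ferrers diagram of shape $(n,n,n-1,n-2,\dots,3,2)$ (a single cell $(1,1)$ if $n=1$). Its cells are written $(i,j)$, where $i$ is the row, numbered from the top, and $j$ is the column label, the columns being labelled $n,n-1,\dots,1$ from left to right. So the cells are $(1,j)$ for $1\le j\le n$ and $(i,j)$ for $2\le i\le n$, $i-1\le j\le n$. The root is $(1,n)$ (top-left cell); the border cells are $(i,i-1)$ for $2\le i\le n$ (the rightmost cells of rows $2,\dots,n$). An fb-tableau of size $n$ is a filling in which each cell is either empty or nonempty such that the root and all border cells are nonempty, and every nonempty cell other than the root has a nonempty cell strictly to its left in the same row or strictly above it in the same column. In an fb-tableau, a nonempty cell different from the root is called a left-arrow ($\leftarrow$) if there is no nonempty cell strictly to its left in its row, an up-arrow ($\uparrow$) if there is no nonempty cell strictly above it in its column, and a dot ($\bullet$) otherwise; the root is also a dot. (Arrows are not dots. Each of rows $2,\dots,n$ has exactly one left-arrow, each of columns $1,\dots,n-1$ has exactly one up-arrow.) A cell is free in an fb-tableau if it lies strictly below an up-arrow (same column) and strictly to the right of a left-arrow (same row); a free cell is either empty or contains a dot. A cell is pointed by an up-arrow if it lies strictly above the up-arrow of its column. That $L$ is an fb-tableau in (3) includes that the symbols placed in (a)–(d) are consistent with the definition of arrows and dots of $L$. *)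

theory Defs
  imports Main
begin

text \<open>
  A cell is a pair (row, column label). Rows are numbered from the top, but column labels decrease
  from left to right, so ``to the left'' means ``larger second component''.
\<close>

type_synonym cell = "nat \<times> nat"

definition board :: "nat \<Rightarrow> cell set" where
  "board n = {(1, j) | j. 1 \<le> j \<and> j \<le> n} \<union> {(i, j) | i j. 2 \<le> i \<and> i \<le> n \<and> i - 1 \<le> j \<and> j \<le> n}"

definition root :: "nat \<Rightarrow> cell" where
  "root n = (1, n)"

definition border :: "nat \<Rightarrow> cell set" where
  "border n = {(i, i - 1) | i. 2 \<le> i \<and> i \<le> n}"

text \<open>A tableau whose cells are merely empty or nonempty is given by its set of nonempty cells.\<close>

definition fb_tableau :: "nat \<Rightarrow> cell set \<Rightarrow> bool" where
  "fb_tableau n T \<longleftrightarrow>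
     T \<subseteq> board n \<and> root n \<in> T \<and> border n \<subseteq> T \<and>
     (\<forall>i j. (i, j) \<in> T \<and> (i, j) \<noteq> root n \<longrightarrow>
        (\<exists>j'>j. (i, j') \<in> T) \<or> (\<exists>i'<i. (i', j) \<in> T))"

datatype symbol = UpArrow | Dot | LeftArrow

instantiation symbol :: linorder
begin

fun rank :: "symbol \<Rightarrow> nat" where
  "rank UpArrow = 0"
| "rank Dot = 1"
| "rank LeftArrow = 2"

definition less_eq_symbol :: "symbol \<Rightarrow> symbol \<Rightarrow> bool" where
  "s \<le> t \<longleftrightarrow> rank s \<le> rank t"

definition less_symbol :: "symbol \<Rightarrow> symbol \<Rightarrow> bool" where
  "s < t \<longleftrightarrow> rank s < rank t"

instance
proof
  fix s t :: symbol
  assume "s \<le> t" "t \<le> s"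
  then show "s = t"
    by (cases s; cases t) (simp_all add: less_eq_symbol_def)
qed (auto simp: less_eq_symbol_def less_symbol_def)

end

text \<open>
  A filling assigns to each cell the set of symbols placed in it. Sets are used because a
  construction that places symbols by independent rules might a priori put several of them into
  the same cell; an empty cell carries the empty set.
\<close>

type_synonym filling = "cell \<Rightarrow> symbol set"

definition left_arrow :: "nat \<Rightarrow> cell set \<Rightarrow> cell \<Rightarrow> bool" where
  "left_arrow n T = (\<lambda>(i, j). (i, j) \<in> T \<and> (i, j) \<noteq> root n \<and> (\<forall>j'>j. (i, j') \<notin> T))"

definition up_arrow :: "nat \<Rightarrow> cell set \<Rightarrow> cell \<Rightarrow> bool" where
  "up_arrow n T = (\<lambda>(i, j). (i, j) \<in> T \<and> (i, j) \<noteq> root n \<and> (\<forall>i'<i. (i', j) \<notin> T))"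

definition filling_of :: "nat \<Rightarrow> cell set \<Rightarrow> filling" where
  "filling_of n T c =
     {s. case s of
           UpArrow \<Rightarrow> up_arrow n T c
         | LeftArrow \<Rightarrow> left_arrow n T c
         | Dot \<Rightarrow> c \<in> T \<and> \<not> up_arrow n T c \<and> \<not> left_arrow n T c}"

text \<open>
  A filling with symbols is an fb-tableau if its nonempty cells form one and all its symbols are
  the ones determined by the nonempty cells.
\<close>

definition fb_filling :: "nat \<Rightarrow> filling \<Rightarrow> bool" where
  "fb_filling n F \<longleftrightarrow> fb_tableau n {c. F c \<noteq> {}} \<and> F = filling_of n {c. F c \<noteq> {}}"

definition free :: "nat \<Rightarrow> filling \<Rightarrow> cell \<Rightarrow> bool" where
  "free n F = (\<lambda>(i, j). (i, j) \<in> board n \<and>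
     (\<exists>i'<i. UpArrow \<in> F (i', j)) \<and> (\<exists>j'>j. LeftArrow \<in> F (i, j')))"

definition up_row :: "filling \<Rightarrow> nat \<Rightarrow> nat" where
  "up_row F j = (THE i. UpArrow \<in> F (i, j))"

definition left_col :: "filling \<Rightarrow> nat \<Rightarrow> nat" where
  "left_col F i = (THE j. LeftArrow \<in> F (i, j))"

context
  fixes n :: nat and M N :: "cell set"
begin

definition combine_ups :: "cell set" where
  "combine_ups =
     {(max (up_row (filling_of n M) j) (up_row (filling_of n N) j), j) | j. 1 \<le> j \<and> j < n}"

definition combine_pointed :: "cell \<Rightarrow> bool" where
  "combine_pointed = (\<lambda>(i, j). \<exists>i'>i. (i', j) \<in> combine_ups)"

definition combine_left_col :: "nat \<Rightarrow> nat" where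
  "combine_left_col i =
     (let p = max (left_col (filling_of n M) i) (left_col (filling_of n N) i)
      in if combine_pointed (i, p) then LEAST j. p < j \<and> \<not> combine_pointed (i, j) else p)"

definition combine_lefts :: "cell set" where
  "combine_lefts = {(i, combine_left_col i) | i. 2 \<le> i \<and> i \<le> n}"

definition combine_arrows :: filling where
  "combine_arrows c =
     (if c \<in> combine_ups then {UpArrow} else {}) \<union> (if c \<in> combine_lefts then {LeftArrow} else {})"

text \<open>
  Freeness depends on the arrows only, so the dots in free cells can be placed once all arrows
  are in position.
\<close>

definition combine_dots :: "cell set" where
  "combine_dots =
     {root n} \<union>
     {c. free n combine_arrows c \<and>
         (Dot \<in> filling_of n M c \<or> \<not> free n (filling_of n M) c) \<and>
         (Dot \<in> filling_of n N c \<or> \<not> free n (filling_of n N) c)}"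

definition combine :: filling where
  "combine c = combine_arrows c \<union> (if c \<in> combine_dots then {Dot} else {})"

end

end

theory Submission
  imports Defs
begin

text \<open>
  In column \<open>j < n\<close> let \<open>u j\<close> be the row of the up-arrow, and in row \<open>i \<ge> 2\<close> let \<open>l i\<close> be the column
  of the left-arrow. A nonempty cell different from the root has a nonempty cell to its left or
  above it, so no cell is both an up-arrow and a left-arrow: the up-arrow of column \<open>j\<close> in a row
  \<open>i \<ge> 2\<close> satisfies \<open>j < l i\<close>. This passes to \<open>L\<close>, whose left-arrows are never to the right of those
  of \<open>M\<close> and \<open>N\<close> and whose up-arrows are taken from \<open>M\<close> or \<open>N\<close>. Since a left-arrow of \<open>L\<close> is not
  pointed, it lies strictly below the up-arrow of its column, or below the root. Finally, a
  left-arrow is only moved across pointed cells, and these are not free; hence every free cell of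
  \<open>L\<close> is to the right of the left-arrow of \<open>M\<close> or of \<open>N\<close>.
\<close>

section \<open>Membership in the board, its border and a filling\<close>

text \<open>In row 1 the condition \<open>i \<le> Suc j\<close> holds automatically, so one formula
  covers both pieces of the board without truncated subtraction.\<close>

lemma board_iff:
  "(i, j) \<in> board n \<longleftrightarrow> 1 \<le> i \<and> i \<le> max 1 n \<and> 1 \<le> j \<and> i \<le> Suc j \<and> j \<le> n"
  by (auto simp: board_def)

lemma border_iff: "(i, j) \<in> border n \<longleftrightarrow> i = Suc j \<and> 1 \<le> j \<and> j < n"
  by (auto simp: border_def)

lemma filling_of_iff [simp]:
  "UpArrow \<in> filling_of n T c \<longleftrightarrow> up_arrow n T c"
  "LeftArrow \<in> filling_of n T c \<longleftrightarrow> left_arrow n T c"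
  "Dot \<in> filling_of n T c \<longleftrightarrow> c \<in> T \<and> \<not> up_arrow n T c \<and> \<not> left_arrow n T c"
  by (auto simp: filling_of_def)

abbreviation tab_up :: "nat \<Rightarrow> cell set \<Rightarrow> nat \<Rightarrow> nat" where
  "tab_up n T \<equiv> up_row (filling_of n T)"

abbreviation tab_left :: "nat \<Rightarrow> cell set \<Rightarrow> nat \<Rightarrow> nat" where
  "tab_left n T \<equiv> left_col (filling_of n T)"

section \<open>Arrows and free cells of a single fb-tableau\<close>

context
  fixes n :: nat and T :: "cell set"
  assumes n: "n \<ge> 1" and T: "fb_tableau n T"
begin

lemma tableau_facts:
  "(i, j) \<in> T \<Longrightarrow> (i, j) \<in> board n" "(1, n) \<in> T" "1 \<le> j \<Longrightarrow> j < n \<Longrightarrow> (Suc j, j) \<in> T"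
  using T by (auto simp: fb_tableau_def root_def border_iff subset_iff)

lemma up_arrow_unique:
  assumes "up_arrow n T (i, j)" "up_arrow n T (i', j)"
  shows "i = i'"
  using assms by (auto simp: up_arrow_def intro: linorder_cases[of i i'])

text \<open>The root is at the top of column \<open>n\<close>, so any other nonempty cell of that
  column has a nonempty cell above it.\<close>

lemma up_arrow_column:
  assumes "up_arrow n T (i, j)"
  shows "1 \<le> j \<and> j < n"
proof -
  have b: "(i, j) \<in> board n"
    using assms tableau_facts(1) by (auto simp: up_arrow_def)
  moreover have "j \<noteq> n"
    using assms b tableau_facts(2)
    by (auto simp: up_arrow_def root_def board_iff)
  ultimately show ?thesis
    by (auto simp: board_iff)
qed

lemma ex_up_arrow:
  assumes "1 \<le> j" "j < n"
  shows "\<exists>i. up_arrow n T (i, j)"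
proof -
  \<comment> \<open>The border cell \<open>(Suc j, j)\<close> makes the column nonempty; its topmost
    nonempty cell is the up-arrow.\<close>
  define i where "i = (LEAST i. (i, j) \<in> T)"
  have "(i, j) \<in> T"
    unfolding i_def using tableau_facts(3)[OF assms] by (rule LeastI)
  moreover have "(i', j) \<notin> T" if "i' < i" for i'
    using that not_less_Least unfolding i_def by blast
  ultimately show ?thesis
    using assms by (auto simp: up_arrow_def root_def)
qed

lemma up_arrow_iff: "up_arrow n T (i, j) \<longleftrightarrow> 1 \<le> j \<and> j < n \<and> i = tab_up n T j"
proof -
  have "up_arrow n T (tab_up n T j, j)" if "1 \<le> j" "j < n"
  proof -
    have "\<exists>!i. up_arrow n T (i, j)"
      using ex_up_arrow[OF that] up_arrow_unique by blast
    from theI'[OF this] show ?thesis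
      by (simp add: up_row_def)
  qed
  then show ?thesis
    using up_arrow_column up_arrow_unique by blast
qed

lemma left_arrow_unique:
  assumes "left_arrow n T (i, j)" "left_arrow n T (i, j')"
  shows "j = j'"
  using assms by (auto simp: left_arrow_def intro: linorder_cases[of j j'])

lemma left_arrow_row:
  assumes "left_arrow n T (i, j)"
  shows "2 \<le> i \<and> i \<le> n"
proof -
  have b: "(i, j) \<in> board n"
    using assms tableau_facts(1) by (auto simp: left_arrow_def)
  moreover have "i \<noteq> 1"
    using assms b tableau_facts(2)
    by (auto simp: left_arrow_def root_def board_iff)
  ultimately show ?thesis
    using n by (auto simp: board_iff)
qed

lemma ex_left_arrow:
  assumes "2 \<le> i" "i \<le> n"
  shows "\<exists>j. left_arrow n T (i, j)"
proof -
  \<comment> \<open>Labels grow to the left, so the leftmost nonempty cell has the greatest label;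
    the bound \<open>n\<close> makes \<open>GREATEST\<close> meaningful.\<close>
  define j where "j = (GREATEST j. (i, j) \<in> T)"
  have bound: "\<And>j. (i, j) \<in> T \<Longrightarrow> j \<le> n"
    using tableau_facts(1) by (auto simp: board_iff)
  have "(i, i - 1) \<in> T"
    using tableau_facts(3)[of "i - 1"] assms by simp
  then have "(i, j) \<in> T"
    unfolding j_def using bound by (rule GreatestI_nat)
  moreover have "(i, j') \<notin> T" if "j < j'" for j'
    using that Greatest_le_nat[of "\<lambda>j. (i, j) \<in> T", OF _ bound] unfolding j_def
    by (meson not_less)
  ultimately show ?thesis
    using assms by (auto simp: left_arrow_def root_def)
qed

lemma left_arrow_iff: "left_arrow n T (i, j) \<longleftrightarrow> 2 \<le> i \<and> i \<le> n \<and> j = tab_left n T i"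
proof -
  have "left_arrow n T (i, tab_left n T i)" if "2 \<le> i" "i \<le> n"
  proof -
    have "\<exists>!j. left_arrow n T (i, j)"
      using ex_left_arrow[OF that] left_arrow_unique by blast
    from theI'[OF this] show ?thesis
      by (simp add: left_col_def)
  qed
  then show ?thesis
    using left_arrow_row left_arrow_unique by blast
qed

lemma tab_up_bounds:
  assumes "1 \<le> j" "j < n"
  shows "1 \<le> tab_up n T j" "tab_up n T j \<le> Suc j"
proof -
  have "up_arrow n T (tab_up n T j, j)"
    using up_arrow_iff assms by blast
  then have "(tab_up n T j, j) \<in> board n"
    using tableau_facts(1) by (auto simp: up_arrow_def)
  then show "1 \<le> tab_up n T j" "tab_up n T j \<le> Suc j"
    by (auto simp: board_iff)
qed

lemma tab_left_bounds:
  assumes "2 \<le> i" "i \<le> n"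
  shows "i \<le> Suc (tab_left n T i)" "tab_left n T i \<le> n"
proof -
  have "left_arrow n T (i, tab_left n T i)"
    using left_arrow_iff assms by blast
  then have "(i, tab_left n T i) \<in> board n"
    using tableau_facts(1) by (auto simp: left_arrow_def)
  then show "i \<le> Suc (tab_left n T i)" "tab_left n T i \<le> n"
    by (auto simp: board_iff)
qed

lemma not_up_and_left: "\<not> (up_arrow n T c \<and> left_arrow n T c)"
  using T by (cases c) (auto simp: up_arrow_def left_arrow_def fb_tableau_def)

lemma less_tab_left:
  assumes "1 \<le> j" "j < n" "2 \<le> tab_up n T j"
  shows "j < tab_left n T (tab_up n T j)"
proof -
  let ?i = "tab_up n T j"
  have i: "2 \<le> ?i" "?i \<le> n"
    using assms tab_up_bounds[of j] by auto
  have "up_arrow n T (?i, j)" "left_arrow n T (?i, tab_left n T ?i)"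
    using assms i up_arrow_iff left_arrow_iff by blast+
  \<comment> \<open>The up-arrow is a nonempty cell of row \<open>?i\<close>, so it cannot lie to
    the left of the left-arrow of that row.\<close>
  then have "j \<le> tab_left n T ?i" "j \<noteq> tab_left n T ?i"
    using not_up_and_left[of "(?i, j)"]
    by (auto simp: up_arrow_def left_arrow_def not_less[symmetric])
  then show ?thesis
    by simp
qed

lemma free_tab_iff:
  "free n (filling_of n T) (i, j) \<longleftrightarrow>
     1 \<le> j \<and> 2 \<le> i \<and> i \<le> n \<and> i \<le> Suc j \<and> tab_up n T j < i \<and> j < tab_left n T i"
  using tab_left_bounds[of i]
  by (auto simp: free_def board_iff up_arrow_iff left_arrow_iff)

text \<open>A border cell is nonempty and no cell carries both arrows, so the order of the two tests
  does not matter.\<close>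

lemma border_filling:
  assumes "1 \<le> j" "j < n"
  shows "filling_of n T (Suc j, j) =
    {if tab_up n T j = Suc j then UpArrow else if tab_left n T (Suc j) = j then LeftArrow else Dot}"
proof -
  have "(Suc j, j) \<in> T"
    using assms by (rule tableau_facts)
  then show ?thesis
    using assms not_up_and_left[of "(Suc j, j)"]
    by (intro set_eqI, rename_tac s, case_tac s)
       (auto simp: up_arrow_iff left_arrow_iff)
qed

end

section \<open>Positions of the arrows of the combined tableau\<close>

context
  fixes n :: nat and M N :: "cell set"
  assumes n: "n \<ge> 1" and M: "fb_tableau n M" and N: "fb_tableau n N"
begin

definition comb_up :: "nat \<Rightarrow> nat" where
  "comb_up j = max (tab_up n M j) (tab_up n N j)"

lemma combine_ups_iff: "(i, j) \<in> combine_ups n M N \<longleftrightarrow> 1 \<le> j \<and> j < n \<and> i = comb_up j"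
  by (auto simp: combine_ups_def comb_up_def)

lemma combine_lefts_iff:
  "(i, j) \<in> combine_lefts n M N \<longleftrightarrow> 2 \<le> i \<and> i \<le> n \<and> j = combine_left_col n M N i"
  by (auto simp: combine_lefts_def)

lemma combine_pointed_iff: "combine_pointed n M N (i, j) \<longleftrightarrow> 1 \<le> j \<and> j < n \<and> i < comb_up j"
  by (auto simp: combine_pointed_def combine_ups_iff)

lemma comb_up_bounds:
  assumes "1 \<le> j" "j < n"
  shows "1 \<le> comb_up j" "comb_up j \<le> Suc j"
  using tab_up_bounds[OF n M assms] tab_up_bounds[OF n N assms] by (auto simp: comb_up_def)

lemma combine_left_col:
  assumes "2 \<le> i" "i \<le> n"
  defines "p \<equiv> max (tab_left n M i) (tab_left n N i)"
  shows "p \<le> combine_left_col n M N i" "combine_left_col n M N i \<le> n"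
    "\<not> combine_pointed n M N (i, combine_left_col n M N i)"
    "\<And>k. p \<le> k \<Longrightarrow> k < combine_left_col n M N i \<Longrightarrow> combine_pointed n M N (i, k)"
proof -
  let ?l = "combine_left_col n M N i"
  let ?P = "\<lambda>j. p < j \<and> \<not> combine_pointed n M N (i, j)"
  have l: "?l = (if combine_pointed n M N (i, p) then Least ?P else p)"
    by (simp add: combine_left_col_def p_def)
  have pn: "p \<le> n"
    using tab_left_bounds[OF n M assms(1,2)] tab_left_bounds[OF n N assms(1,2)]
    by (simp add: p_def)
  have "p \<le> ?l \<and> ?l \<le> n \<and> \<not> combine_pointed n M N (i, ?l) \<and>
    (\<forall>k. p \<le> k \<longrightarrow> k < ?l \<longrightarrow> combine_pointed n M N (i, k))"
  proof (cases "combine_pointed n M N (i, p)")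
    case True
    \<comment> \<open>Column \<open>n\<close> has no up-arrow and hence no pointed cell, so the
      search to the left succeeds at \<open>n\<close> at the latest.\<close>
    then have Pn: "?P n"
      by (auto simp: combine_pointed_iff)
    have "?P (Least ?P)" "Least ?P \<le> n"
      using LeastI[of ?P, OF Pn] Least_le[of ?P, OF Pn] by auto
    moreover have "combine_pointed n M N (i, k)" if "p \<le> k" "k < Least ?P" for k
      using not_less_Least[OF that(2)] that(1) True by (cases "k = p") auto
    ultimately show ?thesis
      using True by (simp add: l)
  next
    case False
    then show ?thesis
      using pn by (simp add: l)
  qed
  then show "p \<le> ?l" "?l \<le> n" "\<not> combine_pointed n M N (i, ?l)"
    "\<And>k. p \<le> k \<Longrightarrow> k < ?l \<Longrightarrow> combine_pointed n M N (i, k)"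
    by auto
qed

lemma less_combine_left_col:
  assumes "1 \<le> j" "j < n" "2 \<le> comb_up j"
  shows "j < combine_left_col n M N (comb_up j)"
proof -
  \<comment> \<open>The row \<open>comb_up j\<close> holds the up-arrow of column \<open>j\<close>
    in \<open>M\<close> or in \<open>N\<close>; in that tableau its left-arrow is already to the
    left of \<open>j\<close>.\<close>
  have "j < max (tab_left n M (comb_up j)) (tab_left n N (comb_up j))"
    using assms less_tab_left[OF n M, of j] less_tab_left[OF n N, of j]
    by (auto simp: comb_up_def max_def split: if_splits)
  also have "\<dots> \<le> combine_left_col n M N (comb_up j)"
    using assms comb_up_bounds[of j] by (intro combine_left_col(1)) auto
  finally show ?thesis .
qed

text \<open>Not being pointed gives only a weak inequality; equality would place both arrows in one
  cell, against \<open>less_combine_left_col\<close>.\<close>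

lemma comb_up_less:
  assumes "2 \<le> i" "i \<le> n" "combine_left_col n M N i < n"
  shows "1 \<le> combine_left_col n M N i" "comb_up (combine_left_col n M N i) < i"
proof -
  let ?l = "combine_left_col n M N i"
  show l1: "1 \<le> ?l"
    using assms combine_left_col(1)[of i] tab_left_bounds[OF n M, of i] by simp
  have "comb_up ?l \<le> i"
    using combine_left_col(3)[of i] assms l1 by (simp add: combine_pointed_iff)
  moreover have "comb_up ?l \<noteq> i"
    using less_combine_left_col[of ?l] assms l1 by auto
  ultimately show "comb_up ?l < i"
    by simp
qed

section \<open>Free cells of the combined tableau\<close>

lemma combine_iff [simp]:
  "UpArrow \<in> combine n M N c \<longleftrightarrow> c \<in> combine_ups n M N"
  "LeftArrow \<in> combine n M N c \<longleftrightarrow> c \<in> combine_lefts n M N"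
  "Dot \<in> combine n M N c \<longleftrightarrow> c \<in> combine_dots n M N"
  by (auto simp: combine_def combine_arrows_def)

lemma combine_nonempty_iff:
  "combine n M N c \<noteq> {} \<longleftrightarrow>
     c \<in> combine_ups n M N \<or> c \<in> combine_lefts n M N \<or> c \<in> combine_dots n M N"
  by (auto simp: combine_def combine_arrows_def)

lemma free_combine_arrows: "free n (combine_arrows n M N) = free n (combine n M N)"
  by (auto simp: free_def fun_eq_iff combine_def combine_arrows_def)

lemma free_combine_iff:
  "free n (combine n M N) (i, j) \<longleftrightarrow>
     1 \<le> j \<and> 2 \<le> i \<and> i \<le> n \<and> i \<le> Suc j \<and> comb_up j < i \<and> j < combine_left_col n M N i"
  using combine_left_col(2)[of i]
  by (auto simp: free_def board_iff combine_ups_iff combine_lefts_iff)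

lemma free_combine_imp:
  assumes "free n (combine n M N) c"
  shows "free n (filling_of n M) c \<or> free n (filling_of n N) c"
proof -
  obtain i j where c: "c = (i, j)"
    by fastforce
  note f = assms[unfolded c free_combine_iff]
  have "\<not> combine_pointed n M N (i, j)"
    using f by (auto simp: combine_pointed_iff)
  \<comment> \<open>Otherwise \<open>j\<close> would be one of the positions that the left-arrow was
    moved across, and these are all pointed. Since \<open>comb_up j\<close> bounds both up-arrow
    rows, the cell is free in whichever tableau attains the maximum.\<close>
  then have "j < max (tab_left n M i) (tab_left n N i)"
    using combine_left_col(4)[of i j] f by force
  then show ?thesis
    using f by (auto simp: c free_tab_iff[OF n M] free_tab_iff[OF n N] comb_up_def)
qed

lemma free_combineI:
  assumes "free n (filling_of n M) c" "free n (filling_of n N) c"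
  shows "free n (combine n M N) c"
proof -
  obtain i j where c: "c = (i, j)"
    by fastforce
  show ?thesis
    using assms combine_left_col(1)[of i]
    by (auto simp: c free_tab_iff[OF n M] free_tab_iff[OF n N] free_combine_iff comb_up_def)
qed

section \<open>Dots and border cells\<close>

lemma combine_dots_cases:
  assumes "(i, j) \<in> combine_dots n M N"
  obtains "i = 1" "j = n"
  | "1 \<le> j" "j < n" "2 \<le> i" "i \<le> n" "i \<le> Suc j" "comb_up j < i" "j < combine_left_col n M N i"
  using assms combine_left_col(2)[of i]
  by (auto simp: combine_dots_def root_def free_combine_arrows free_combine_iff)

lemma border_combine:
  assumes "1 \<le> j" "j < n"
  shows "combine n M N (Suc j, j) =
    {if comb_up j = Suc j then UpArrow
     else if max (tab_left n M (Suc j)) (tab_left n N (Suc j)) = j then LeftArrow else Dot}"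
proof -
  let ?p = "max (tab_left n M (Suc j)) (tab_left n N (Suc j))"
  let ?l = "combine_left_col n M N (Suc j)"
  have np: "\<not> combine_pointed n M N (Suc j, j)"
    using comb_up_bounds[OF assms] by (auto simp: combine_pointed_iff)
  have jp: "j \<le> ?p"
    using tab_left_bounds[OF n M, of "Suc j"] assms by auto
  have pl: "?p \<le> ?l"
    using assms by (intro combine_left_col(1)) auto
  \<comment> \<open>A border cell is at the bottom of its column and so never pointed: a left-arrow
    that starts there is not moved, and none is moved there from the right.\<close>
  have lj: "?l = j \<longleftrightarrow> ?p = j"
    using jp pl np combine_left_col(4)[of "Suc j" j] assms by force
  have up: "(Suc j, j) \<in> combine_ups n M N \<longleftrightarrow> comb_up j = Suc j"
    using assms by (auto simp: combine_ups_iff)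
  have left: "(Suc j, j) \<in> combine_lefts n M N \<longleftrightarrow> ?p = j"
    using assms lj by (auto simp: combine_lefts_iff)
  have excl: "?p \<noteq> j" if "comb_up j = Suc j"
    using less_combine_left_col[OF assms] that lj assms by auto
  have dot: "(Suc j, j) \<in> combine_dots n M N \<longleftrightarrow> comb_up j \<noteq> Suc j \<and> ?p \<noteq> j"
  proof
    assume "(Suc j, j) \<in> combine_dots n M N"
    then show "comb_up j \<noteq> Suc j \<and> ?p \<noteq> j"
      by (rule combine_dots_cases) (use assms lj in auto)
  next
    assume *: "comb_up j \<noteq> Suc j \<and> ?p \<noteq> j"
    then have "free n (combine n M N) (Suc j, j)"
      using assms comb_up_bounds[OF assms] jp pl by (auto simp: free_combine_iff)
    \<comment> \<open>A border cell is nonempty, and a free cell carries no arrow; if it is free in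
      \<open>T\<close>, it therefore contains a dot.\<close>
    moreover have "Dot \<in> filling_of n T (Suc j, j) \<or> \<not> free n (filling_of n T) (Suc j, j)"
      if T: "fb_tableau n T" for T
      using free_tab_iff[OF n T] border_filling[OF n T assms] by auto
    ultimately show "(Suc j, j) \<in> combine_dots n M N"
      using M N by (simp add: combine_dots_def free_combine_arrows del: filling_of_iff)
  qed
  show ?thesis
    using up left dot excl
    by (intro set_eqI, rename_tac s, case_tac s) auto
qed

text \<open>No up-arrow of the column is below the border cell, so the lower one is there iff at
  least one is. No left-arrow of the row is to its right, so the leftmost one is there iff both are.
  This is the minimum in the given order.\<close>

lemma border_combine_min:
  assumes "c \<in> border n"
  shows "\<exists>e\<^sub>M e\<^sub>N e\<^sub>L. filling_of n M c = {e\<^sub>M} \<and> filling_of n N c = {e\<^sub>N} \<and>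
    combine n M N c = {e\<^sub>L} \<and> e\<^sub>L = min e\<^sub>M e\<^sub>N"
proof -
  obtain j where j: "c = (Suc j, j)" "1 \<le> j" "j < n"
    using assms by (cases c) (auto simp: border_iff)
  have b: "tab_up n M j \<le> Suc j" "tab_up n N j \<le> Suc j"
    "j \<le> tab_left n M (Suc j)" "j \<le> tab_left n N (Suc j)"
    using tab_up_bounds[OF n M, of j] tab_up_bounds[OF n N, of j]
      tab_left_bounds[OF n M, of "Suc j"] tab_left_bounds[OF n N, of "Suc j"] j by auto
  show ?thesis
    unfolding j(1) border_combine[OF j(2,3)] border_filling[OF n M j(2,3)]
      border_filling[OF n N j(2,3)]
    using b by (auto simp: comb_up_def min_def max_def less_eq_symbol_def)
qed

section \<open>The combined tableau is an fb-tableau\<close>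

lemma combine_cell_bounds:
  assumes "combine n M N (i, j) \<noteq> {}"
  shows "(i, j) \<in> board n" "j < n \<Longrightarrow> comb_up j \<le> i" "2 \<le> i \<Longrightarrow> j \<le> combine_left_col n M N i"
proof -
  consider (up) "1 \<le> j" "j < n" "i = comb_up j"
    | (left) "2 \<le> i" "i \<le> n" "j = combine_left_col n M N i"
    | (dot) "(i, j) \<in> combine_dots n M N"
    using assms by (auto simp: combine_nonempty_iff combine_ups_iff combine_lefts_iff)
  then have "(i, j) \<in> board n \<and> (j < n \<longrightarrow> comb_up j \<le> i) \<and>
    (2 \<le> i \<longrightarrow> j \<le> combine_left_col n M N i)"
  proof cases
    case up
    \<comment> \<open>If \<open>comb_up j = 1\<close>, the bound on the left-arrow is vacuous;
      otherwise it is \<open>less_combine_left_col\<close>.\<close>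
    then show ?thesis
      using comb_up_bounds[of j] less_combine_left_col[of j] by (auto simp: board_iff)
  next
    case left
    then show ?thesis
      using combine_left_col(1,2)[of i] tab_left_bounds[OF n M, of i] comb_up_less[of i]
      by (auto simp: board_iff)
  next
    case dot
    then show ?thesis
      by (rule combine_dots_cases) (use n in \<open>auto simp: board_iff\<close>)
  qed
  then show "(i, j) \<in> board n" "j < n \<Longrightarrow> comb_up j \<le> i"
    "2 \<le> i \<Longrightarrow> j \<le> combine_left_col n M N i"
    by auto
qed

lemma root_combine: "combine n M N (1, n) \<noteq> {}"
  by (simp add: combine_nonempty_iff combine_dots_def root_def)

lemma up_combine: "1 \<le> j \<Longrightarrow> j < n \<Longrightarrow> combine n M N (comb_up j, j) \<noteq> {}"
  by (simp add: combine_nonempty_iff combine_ups_iff)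

lemma left_combine: "2 \<le> i \<Longrightarrow> i \<le> n \<Longrightarrow> combine n M N (i, combine_left_col n M N i) \<noteq> {}"
  by (simp add: combine_nonempty_iff combine_lefts_iff)

text \<open>By \<open>combine_cell_bounds\<close> every nonempty cell of a column
  \<open>j < n\<close> lies weakly below the up-arrow placed by the rule, which is itself nonempty
  and hence the topmost one.\<close>

lemma up_arrow_combine_iff:
  "up_arrow n {c. combine n M N c \<noteq> {}} (i, j) \<longleftrightarrow> (i, j) \<in> combine_ups n M N"
proof
  assume up: "up_arrow n {c. combine n M N c \<noteq> {}} (i, j)"
  then have ne: "combine n M N (i, j) \<noteq> {}" and nr: "(i, j) \<noteq> (1, n)"
    and top: "\<And>i'. i' < i \<Longrightarrow> combine n M N (i', j) = {}"
    by (auto simp: up_arrow_def root_def)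
  note b = combine_cell_bounds[OF ne]
  have "j \<noteq> n"
    using top[of 1] root_combine nr b(1) by (force simp: board_iff)
  then have j: "1 \<le> j" "j < n"
    using b(1) by (auto simp: board_iff)
  then have "i = comb_up j"
    using b(2) top[of "comb_up j"] up_combine[of j] by force
  then show "(i, j) \<in> combine_ups n M N"
    using j by (simp add: combine_ups_iff)
next
  assume "(i, j) \<in> combine_ups n M N"
  then have j: "1 \<le> j" "j < n" "i = comb_up j"
    by (auto simp: combine_ups_iff)
  moreover have "combine n M N (i', j) = {}" if "i' < i" for i'
    using combine_cell_bounds(2)[of i' j] that j by force
  ultimately show "up_arrow n {c. combine n M N c \<noteq> {}} (i, j)"
    using up_combine[of j] by (simp add: up_arrow_def root_def)
qed

text \<open>The same argument along rows: the third bound of \<open>combine_cell_bounds\<close>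
  makes the placed left-arrow the leftmost nonempty cell of its row.\<close>

lemma left_arrow_combine_iff:
  "left_arrow n {c. combine n M N c \<noteq> {}} (i, j) \<longleftrightarrow> (i, j) \<in> combine_lefts n M N"
proof
  assume left: "left_arrow n {c. combine n M N c \<noteq> {}} (i, j)"
  then have ne: "combine n M N (i, j) \<noteq> {}" and nr: "(i, j) \<noteq> (1, n)"
    and first: "\<And>j'. j < j' \<Longrightarrow> combine n M N (i, j') = {}"
    by (auto simp: left_arrow_def root_def)
  note b = combine_cell_bounds[OF ne]
  have "i \<noteq> 1"
    using first[of n] root_combine nr b(1) by (force simp: board_iff)
  then have i: "2 \<le> i" "i \<le> n"
    using b(1) n by (auto simp: board_iff)
  then have "j = combine_left_col n M N i"
    using b(3) first[of "combine_left_col n M N i"] left_combine[of i] by force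
  then show "(i, j) \<in> combine_lefts n M N"
    using i by (simp add: combine_lefts_iff)
next
  assume "(i, j) \<in> combine_lefts n M N"
  then have i: "2 \<le> i" "i \<le> n" "j = combine_left_col n M N i"
    by (auto simp: combine_lefts_iff)
  moreover have "combine n M N (i, j') = {}" if "j < j'" for j'
    using combine_cell_bounds(3)[of i j'] that i by force
  ultimately show "left_arrow n {c. combine n M N c \<noteq> {}} (i, j)"
    using left_combine[of i] by (simp add: left_arrow_def root_def)
qed

lemma combine_ups_lefts_disjoint: "(i, j) \<in> combine_ups n M N \<Longrightarrow> (i, j) \<notin> combine_lefts n M N"
  using less_combine_left_col[of j] by (auto simp: combine_ups_iff combine_lefts_iff)

text \<open>Free cells are strictly below and strictly to the right of the arrows, and the root lies
  in the one row and the one column without an arrow.\<close>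

lemma combine_dots_no_arrow:
  assumes "(i, j) \<in> combine_dots n M N"
  shows "(i, j) \<notin> combine_ups n M N \<and> (i, j) \<notin> combine_lefts n M N"
  using assms by (rule combine_dots_cases) (auto simp: combine_ups_iff combine_lefts_iff)

lemma fb_tableau_combine: "fb_tableau n {c. combine n M N c \<noteq> {}}"
proof -
  \<comment> \<open>A violating cell would be both an up-arrow and a left-arrow of the set of
    nonempty cells, hence a position of both kinds under the placement rules.\<close>
  have "(\<exists>j'>j. combine n M N (i, j') \<noteq> {}) \<or> (\<exists>i'<i. combine n M N (i', j) \<noteq> {})"
    if "combine n M N (i, j) \<noteq> {}" "(i, j) \<noteq> (1, n)" for i j
    using that combine_ups_lefts_disjoint[of i j]
      up_arrow_combine_iff[of i j] left_arrow_combine_iff[of i j]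
    unfolding up_arrow_def left_arrow_def root_def by auto
  moreover have "combine n M N c \<noteq> {}" if "c \<in> border n" for c
    using border_combine_min[OF that] by auto
  ultimately show ?thesis
    using combine_cell_bounds(1) root_combine
    unfolding fb_tableau_def root_def by (auto simp del: ex_in_conv) blast+
qed

lemma combine_eq_filling_of: "combine n M N = filling_of n {c. combine n M N c \<noteq> {}}"
proof (intro ext set_eqI)
  fix c :: cell and s
  obtain i j where c: "c = (i, j)"
    by fastforce
  define S where "S = {c. combine n M N c \<noteq> {}}"
  have "(i, j) \<in> S \<longleftrightarrow>
      (i, j) \<in> combine_ups n M N \<or> (i, j) \<in> combine_lefts n M N \<or> (i, j) \<in> combine_dots n M N"
    "up_arrow n S (i, j) \<longleftrightarrow> (i, j) \<in> combine_ups n M N"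
    "left_arrow n S (i, j) \<longleftrightarrow> (i, j) \<in> combine_lefts n M N"
    by (simp_all only: S_def mem_Collect_eq combine_nonempty_iff[symmetric]
        up_arrow_combine_iff left_arrow_combine_iff)
  then have "s \<in> combine n M N c \<longleftrightarrow> s \<in> filling_of n S c"
    using combine_dots_no_arrow[of i j] by (cases s) (auto simp: c)
  then show "s \<in> combine n M N c \<longleftrightarrow> s \<in> filling_of n {c. combine n M N c \<noteq> {}} c"
    by (simp only: S_def)
qed

end

theorem lemma2p9:
  fixes n :: nat and M N :: "cell set"
  assumes "n \<ge> 1" and "fb_tableau n M" and "fb_tableau n N"
  shows
    "(\<forall>c. free n (combine n M N) c \<longrightarrow> free n (filling_of n M) c \<or> free n (filling_of n N) c) \<and>
     (\<forall>c. free n (filling_of n M) c \<and> free n (filling_of n N) c \<longrightarrow> free n (combine n M N) c) \<and>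
     (\<forall>c\<in>border n. \<exists>e\<^sub>M e\<^sub>N e\<^sub>L.
        filling_of n M c = {e\<^sub>M} \<and> filling_of n N c = {e\<^sub>N} \<and> combine n M N c = {e\<^sub>L} \<and>
        e\<^sub>L = min e\<^sub>M e\<^sub>N) \<and>
     fb_filling n (combine n M N)"
  using free_combine_imp[OF assms] free_combineI[OF assms] border_combine_min[OF assms]
    fb_tableau_combine[OF assms] combine_eq_filling_of[OF assms]
  unfolding fb_filling_def by blast

end
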